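(* Let $E$ be a Dedekind complete vector lattice. Suppose that $(S_\alpha)_{\alpha\in A}$ is a net in $\mathcal{L}_{\mathrm{oc}}(E)$ such that $S_\alpha\xrightarrow{\mathrm{o}}S$ in $\mathcal{L}_{\mathrm{ob}}(E)$ for some $S\in\mathcal{L}_{\mathrm{ob}}(E)$, and that $(T_\beta)_{\beta\in B}$ is a net in $\mathcal{L}_{\mathrm{ob}}(E)$ such that $T_\beta\xrightarrow{\mathrm{o}}T$ in $\mathcal{L}_{\mathrm{ob}}(E)$ for some $T\in\mathcal{L}_{\mathrm{ob}}(E)$. Then $S\in\mathcal{L}_{\mathrm{oc}}(E)$ and $S_\alpha T_\beta\xrightarrow{\mathrm{o}}ST$ in $\mathcal{L}_{\mathrm{ob}}(E)$.
   Context: All vector lattices are real and Archimedean. $\mathcal{L}_{\mathrm{ob}}(E)$ is the space of order bounded linear operators on $E$, a Dedekind complete vector lattice in the operator order when $E$ is Dedekind complete; $\mathcal{L}_{\mathrm{oc}}(E)$ is its subset of order continuous operators (those $T$ for which $x_\alpha\xrightarrow{\mathrm{o}}0$ in $E$ implies $Tx_\alpha\xrightarrow{\mathrm{o}}0$ in $E$ for every net). In a vector lattice $G$, a net $(x_\alpha)_{\alpha\in A}$ is order convergent to $x$ ($x_\alpha\xrightarrow{\mathrm{o}}x$) if there is a net $(y_\beta)_{\beta\in B}$ in $G$ with $y_\beta\downarrow 0$ such that for every $\beta_0\in B$ there is $\alpha_0\in A$ with $|x-x_\alpha|\le y_{\beta_0}$ for all $\alpha\ge\alpha_0$. The net $(S_\alpha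 T_\beta)$ is indexed by $A\times B$ with the product order. *)

theory Defs
  imports "HOL-Library.Lattice_Algebras"
begin

section \<open>Vector lattices\<close>

text \<open>
  The modulus is the one of \<^class>\<open>lattice_ab_group_add_abs\<close>, i.e. \<open>\<bar>x\<bar> = sup x (- x)\<close>. The
  Archimedean property is not an axiom of the class: it follows from Dedekind completeness
  for the base lattice, and is inherited by the operators on it.
\<close>

class vector_lattice = ordered_real_vector + lattice_ab_group_add_abs

text \<open>
  In \<^class>\<open>conditionally_complete_lattice\<close> every nonempty set that is bounded above has a supremum,
  and dually. The values of \<open>Sup\<close> and \<open>Inf\<close> on other sets are unspecified.
\<close>

class dedekind_complete_vector_lattice = vector_lattice + conditionally_complete_lattice


section \<open>Nets and order convergence\<close>

definition directed_set :: "'i set \<Rightarrow> 'i rel \<Rightarrow> bool" where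
  "directed_set A r \<longleftrightarrow> A \<noteq> {} \<and> preorder_on A r \<and>
     (\<forall>a\<in>A. \<forall>b\<in>A. \<exists>c\<in>A. (a, c) \<in> r \<and> (b, c) \<in> r)"

definition product_order :: "'i rel \<Rightarrow> 'j rel \<Rightarrow> ('i \<times> 'j) rel" where
  "product_order r s = {((a, b), (a', b')). (a, a') \<in> r \<and> (b, b') \<in> s}"

definition decreases_to_zero :: "'i set \<Rightarrow> 'i rel \<Rightarrow> ('i \<Rightarrow> 'g::vector_lattice) \<Rightarrow> bool" where
  "decreases_to_zero B s y \<longleftrightarrow>
     (\<forall>b\<in>B. \<forall>c\<in>B. (b, c) \<in> s \<longrightarrow> y c \<le> y b) \<and>
     (\<forall>b\<in>B. 0 \<le> y b) \<and> (\<forall>z. (\<forall>b\<in>B. z \<le> y b) \<longrightarrow> z \<le> 0)"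

text \<open>
  A definition cannot quantify over the type of the index set of the dominating net, so
  its index set is taken inside \<open>'g\<close>. This is no restriction, as a decreasing net can be reindexed
  by its range: see \<open>order_convergentI\<close> below.
\<close>

definition order_convergent ::
    "'i set \<Rightarrow> 'i rel \<Rightarrow> ('i \<Rightarrow> 'g::vector_lattice) \<Rightarrow> 'g \<Rightarrow> bool" where
  "order_convergent A r x l \<longleftrightarrow>
     (\<exists>(B :: 'g set) s (y :: 'g \<Rightarrow> 'g). directed_set B s \<and> decreases_to_zero B s y \<and>
        (\<forall>b\<in>B. \<exists>a\<^sub>0\<in>A. \<forall>a\<in>A. (a\<^sub>0, a) \<in> r \<longrightarrow> \<bar>l - x a\<bar> \<le> y b))"

lemma order_convergentI:
  fixes B :: "'j set" and y :: "'j \<Rightarrow> 'g::vector_lattice"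
  assumes B: "directed_set B s" and y: "decreases_to_zero B s y"
    and dom: "\<And>b. b \<in> B \<Longrightarrow> \<exists>a\<^sub>0\<in>A. \<forall>a\<in>A. (a\<^sub>0, a) \<in> r \<longrightarrow> \<bar>l - x a\<bar> \<le> y b"
  shows "order_convergent A r x l"
proof -
  let ?B = "y ` B"
  let ?s = "{(u, v). u \<in> ?B \<and> v \<in> ?B \<and> v \<le> u}"
  have "\<exists>w\<in>?B. (u, w) \<in> ?s \<and> (v, w) \<in> ?s" if "u \<in> ?B" "v \<in> ?B" for u v
  proof -
    from that obtain b c where bc: "b \<in> B" "c \<in> B" "u = y b" "v = y c"
      by blast
    obtain d where "d \<in> B" "(b, d) \<in> s" "(c, d) \<in> s"
      using B bc unfolding directed_set_def by blast
    then show ?thesis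
      using y bc unfolding decreases_to_zero_def by blast
  qed
  then have "directed_set ?B ?s"
    using B unfolding directed_set_def preorder_on_def refl_on_def trans_def by auto
  moreover have "decreases_to_zero ?B ?s (\<lambda>u. u)"
    using y unfolding decreases_to_zero_def by auto
  moreover have "\<forall>b\<in>?B. \<exists>a\<^sub>0\<in>A. \<forall>a\<in>A. (a\<^sub>0, a) \<in> r \<longrightarrow> \<bar>l - x a\<bar> \<le> b"
    using dom by blast
  ultimately show ?thesis
    unfolding order_convergent_def by blast
qed


section \<open>Order bounded operators\<close>

definition order_bounded ::
    "('a::dedekind_complete_vector_lattice \<Rightarrow> 'a) \<Rightarrow> bool" where
  "order_bounded f \<longleftrightarrow> (\<forall>a b. \<exists>c d. f ` {a..b} \<subseteq> {c..d})"

lemma order_bounded_zero: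
  "order_bounded (\<lambda>x :: 'a::dedekind_complete_vector_lattice. 0)"
  unfolding order_bounded_def
proof (intro allI)
  fix a b :: 'a
  show "\<exists>c d. (\<lambda>x. 0 :: 'a) ` {a..b} \<subseteq> {c..d}"
    by (intro exI[of _ 0]) auto
qed

lemma order_bounded_add:
  assumes "order_bounded f" "order_bounded g"
  shows "order_bounded (\<lambda>x. f x + g x)"
  unfolding order_bounded_def
proof (intro allI)
  fix a b
  obtain c d c' d' where "f ` {a..b} \<subseteq> {c..d}" "g ` {a..b} \<subseteq> {c'..d'}"
    using assms unfolding order_bounded_def by meson
  then have "(\<lambda>x. f x + g x) ` {a..b} \<subseteq> {c + c'..d + d'}"
    by (auto simp: image_subset_iff intro!: add_mono)
  then show "\<exists>c d. (\<lambda>x. f x + g x) ` {a..b} \<subseteq> {c..d}" by blast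
qed

lemma order_bounded_uminus:
  assumes "order_bounded f"
  shows "order_bounded (\<lambda>x. - f x)"
  unfolding order_bounded_def
proof (intro allI)
  fix a b
  obtain c d where "f ` {a..b} \<subseteq> {c..d}"
    using assms unfolding order_bounded_def by meson
  then have "(\<lambda>x. - f x) ` {a..b} \<subseteq> {- d..- c}"
    by (auto simp: image_subset_iff)
  then show "\<exists>c d. (\<lambda>x. - f x) ` {a..b} \<subseteq> {c..d}" by blast
qed

lemma order_bounded_scaleR_nonneg:
  assumes "order_bounded f" "0 \<le> k"
  shows "order_bounded (\<lambda>x. k *\<^sub>R f x)"
  unfolding order_bounded_def
proof (intro allI)
  fix a b
  obtain c d where "f ` {a..b} \<subseteq> {c..d}"
    using assms(1) unfolding order_bounded_def by meson
  then have "(\<lambda>x. k *\<^sub>R f x) ` {a..b} \<subseteq> {k *\<^sub>R c..k *\<^sub>R d}"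
    using assms(2) by (auto simp: image_subset_iff intro!: scaleR_left_mono)
  then show "\<exists>c d. (\<lambda>x. k *\<^sub>R f x) ` {a..b} \<subseteq> {c..d}" by blast
qed

lemma order_bounded_scaleR:
  assumes "order_bounded f"
  shows "order_bounded (\<lambda>x. k *\<^sub>R f x)"
proof (cases "0 \<le> k")
  case True
  then show ?thesis using assms order_bounded_scaleR_nonneg by blast
next
  case False
  then show ?thesis
    using order_bounded_scaleR_nonneg[OF order_bounded_uminus[OF assms], of "- k"] by simp
qed

lemma order_bounded_comp:
  assumes "order_bounded f" "order_bounded g"
  shows "order_bounded (f \<circ> g)"
  unfolding order_bounded_def
proof (intro allI)
  fix a b
  obtain c d where 1: "g ` {a..b} \<subseteq> {c..d}"
    using assms(2) unfolding order_bounded_def by meson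
  obtain c' d' where 2: "f ` {c..d} \<subseteq> {c'..d'}"
    using assms(1) unfolding order_bounded_def by meson
  have "(f \<circ> g) ` {a..b} \<subseteq> {c'..d'}"
    using 1 2 by (auto simp: image_subset_iff)
  then show "\<exists>c d. (f \<circ> g) ` {a..b} \<subseteq> {c..d}" by blast
qed

typedef (overloaded) 'a ob_operator =
    "{f :: 'a::dedekind_complete_vector_lattice \<Rightarrow> 'a. linear f \<and> order_bounded f}"
  morphisms apply_op Abs_ob_operator
proof
  show "(\<lambda>x. 0) \<in> {f :: 'a \<Rightarrow> 'a. linear f \<and> order_bounded f}"
    by (auto simp: linear_iff order_bounded_zero)
qed

setup_lifting type_definition_ob_operator

lemma linear_apply_op: "linear (apply_op T)"
  and order_bounded_apply_op: "order_bounded (apply_op T)"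
  using apply_op[of T] by auto

lift_definition comp_op ::
    "'a::dedekind_complete_vector_lattice ob_operator \<Rightarrow> 'a ob_operator \<Rightarrow> 'a ob_operator"
    (infixl "\<cdot>" 70) is "\<lambda>f g. f \<circ> g"
  by (auto intro: linear_compose order_bounded_comp)

instantiation ob_operator :: (dedekind_complete_vector_lattice) real_vector
begin

lift_definition zero_ob_operator :: "'a ob_operator" is "\<lambda>x. 0"
  by (auto simp: linear_iff order_bounded_zero)

lift_definition plus_ob_operator :: "'a ob_operator \<Rightarrow> 'a ob_operator \<Rightarrow> 'a ob_operator"
  is "\<lambda>f g x. f x + g x"
  by (auto intro: linear_compose_add order_bounded_add)

lift_definition uminus_ob_operator :: "'a ob_operator \<Rightarrow> 'a ob_operator"
  is "\<lambda>f x. - f x"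
  by (auto intro: linear_compose_neg order_bounded_uminus)

lift_definition minus_ob_operator :: "'a ob_operator \<Rightarrow> 'a ob_operator \<Rightarrow> 'a ob_operator"
  is "\<lambda>f g x. f x - g x"
  using order_bounded_add[OF _ order_bounded_uminus] by (auto intro: linear_compose_sub)

lift_definition scaleR_ob_operator :: "real \<Rightarrow> 'a ob_operator \<Rightarrow> 'a ob_operator"
  is "\<lambda>k f x. k *\<^sub>R f x"
  by (auto intro: linear_compose_scale_right order_bounded_scaleR)

instance
  by standard (transfer; auto simp: algebra_simps fun_eq_iff)+

end

instantiation ob_operator :: (dedekind_complete_vector_lattice) ordered_real_vector
begin

lift_definition less_eq_ob_operator :: "'a ob_operator \<Rightarrow> 'a ob_operator \<Rightarrow> bool"
  is "\<lambda>f g. \<forall>x\<ge>0. f x \<le> g x" .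

definition less_ob_operator :: "'a ob_operator \<Rightarrow> 'a ob_operator \<Rightarrow> bool" where
  "S < T \<longleftrightarrow> S \<le> T \<and> \<not> T \<le> (S :: 'a ob_operator)"

instance
proof
  fix S T U :: "'a ob_operator" and k m :: real
  show "S < T \<longleftrightarrow> S \<le> T \<and> \<not> T \<le> S" by (rule less_ob_operator_def)
  show "S \<le> S" by transfer simp
  show "S \<le> T \<Longrightarrow> T \<le> U \<Longrightarrow> S \<le> U" by transfer (blast intro: order_trans)
  show "S \<le> T \<Longrightarrow> U + S \<le> U + T" by transfer simp
  show "S \<le> T \<Longrightarrow> 0 \<le> k \<Longrightarrow> k *\<^sub>R S \<le> k *\<^sub>R T"
    by transfer (auto intro: scaleR_left_mono)
  show "k \<le> m \<Longrightarrow> 0 \<le> S \<Longrightarrow> k *\<^sub>R S \<le> m *\<^sub>R S"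
    by transfer (auto intro: scaleR_right_mono)
  show "S \<le> T \<Longrightarrow> T \<le> S \<Longrightarrow> S = T"
  proof transfer
    fix f g :: "'a \<Rightarrow> 'a"
    assume f: "linear f \<and> order_bounded f" and g: "linear g \<and> order_bounded g"
      and "\<forall>x\<ge>0. f x \<le> g x" "\<forall>x\<ge>0. g x \<le> f x"
    then have eq: "f x = g x" if "0 \<le> x" for x
      using that by (blast intro: antisym)
    show "f = g"
    proof
      fix x :: 'a
      have "x = pprt x - pprt (- x)"
        using prts[of x] by (simp add: pprt_neg)
      then have "f x = f (pprt x) - f (pprt (- x))" "g x = g (pprt x) - g (pprt (- x))"
        using f g linear_diff by metis+
      then show "f x = g x"
        by (simp add: eq)
    qed
  qed
qed

end

text \<open>The Riesz--Kantorovich formula for the positive part of an order bounded operator.\<close>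

lemma riesz_decomposition:
  fixes x y z :: "'a::vector_lattice"
  assumes "0 \<le> x" "0 \<le> y" "0 \<le> z" "z \<le> x + y"
  obtains u v where "z = u + v" "0 \<le> u" "u \<le> x" "0 \<le> v" "v \<le> y"
proof
  show "z = inf z x + (z - inf z x)" by (simp only: add_diff_eq add_diff_cancel_left')
  show "0 \<le> inf z x" "inf z x \<le> x" using assms by simp_all
  show "0 \<le> z - inf z x" unfolding diff_ge_0_iff_ge by (rule inf_le1)
  have "z - y \<le> inf z x" using assms by (simp add: diff_le_eq)
  then show "z - inf z x \<le> y"
    by (simp only: diff_le_eq add.commute[of y])
qed

lemma riesz_kantorovich:
  fixes h :: "'a::dedekind_complete_vector_lattice \<Rightarrow> 'a"
  assumes h: "linear h" "order_bounded h"
  shows "\<exists>p. linear p \<and> order_bounded p \<and> (\<forall>x\<ge>0. p x = Sup (h ` {0..x}))"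
proof -
  define q where "q x = Sup (h ` {0..x})" for x
  define p where "p x = q (pprt x) - q (pprt (- x))" for x
  have bdd: "bdd_above (h ` {0..x})" for x
  proof -
    obtain c d where "h ` {0..x} \<subseteq> {c..d}"
      using h(2) unfolding order_bounded_def by meson
    then show ?thesis by (rule bdd_above_mono[OF bdd_above_Icc])
  qed
  have upper: "h y \<le> q x" if "0 \<le> y" "y \<le> x" for x y
    unfolding q_def using that by (intro cSup_upper bdd) auto
  have least: "q x \<le> z" if "0 \<le> x" "\<And>y. 0 \<le> y \<Longrightarrow> y \<le> x \<Longrightarrow> h y \<le> z" for x z
    unfolding q_def using that by (intro cSup_least) auto
  have q_nonneg: "0 \<le> q x" if "0 \<le> x" for x
    using upper[of 0 x] that h(1) by (simp add: linear_0)
  have q_add: "q (x + y) = q x + q y" if xy: "0 \<le> x" "0 \<le> y" for x y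
  proof (rule antisym)
    show "q (x + y) \<le> q x + q y"
    proof (rule least)
      fix z assume "0 \<le> z" "z \<le> x + y"
      then obtain u v where "z = u + v" "0 \<le> u" "u \<le> x" "0 \<le> v" "v \<le> y"
        using riesz_decomposition xy by metis
      then show "h z \<le> q x + q y"
        using h(1) upper by (simp add: linear_add add_mono)
    qed (use xy in simp)
    have "q x \<le> q (x + y) - q y"
    proof (rule least)
      fix u assume u: "0 \<le> u" "u \<le> x"
      have "q y \<le> q (x + y) - h u"
      proof (rule least)
        fix v assume v: "0 \<le> v" "v \<le> y"
        have "h (u + v) \<le> q (x + y)"
          using u v by (intro upper add_mono) simp_all
        then show "h v \<le> q (x + y) - h u"
          using h(1) by (simp add: linear_add le_diff_eq add.commute)
      qed (use xy in simp)
      then show "h u \<le> q (x + y) - q y"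
        by (simp add: le_diff_eq add.commute)
    qed (use xy in simp)
    then show "q x + q y \<le> q (x + y)" by (simp add: le_diff_eq)
  qed
  have q_scale_le: "q (k *\<^sub>R x) \<le> k *\<^sub>R q x" if k: "0 < k" and x: "0 \<le> x" for k x
  proof (rule least)
    fix z assume z: "0 \<le> z" "z \<le> k *\<^sub>R x"
    have "inverse k *\<^sub>R z \<le> inverse k *\<^sub>R (k *\<^sub>R x)"
      using z k by (intro scaleR_left_mono) auto
    then have "h (inverse k *\<^sub>R z) \<le> q x"
      using z k by (intro upper) (auto intro: scaleR_nonneg_nonneg)
    then have "k *\<^sub>R h (inverse k *\<^sub>R z) \<le> k *\<^sub>R q x"
      using k by (intro scaleR_left_mono) auto
    then show "h z \<le> k *\<^sub>R q x"
      using h(1) k by (simp add: linear_cmul)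
  qed (use k x in \<open>simp add: scaleR_nonneg_nonneg\<close>)
  have q0: "q 0 = 0"
    using q_add[of 0 0] by simp
  have q_scale: "q (k *\<^sub>R x) = k *\<^sub>R q x" if k: "0 \<le> k" and x: "0 \<le> x" for k x
  proof (cases "k = 0")
    case True
    then show ?thesis using q0 by simp
  next
    case False
    with k have k: "0 < k" by simp
    have "q (inverse k *\<^sub>R (k *\<^sub>R x)) \<le> inverse k *\<^sub>R q (k *\<^sub>R x)"
      using k x by (intro q_scale_le) (auto intro: scaleR_nonneg_nonneg)
    then have "k *\<^sub>R q x \<le> k *\<^sub>R (inverse k *\<^sub>R q (k *\<^sub>R x))"
      using k by (intro scaleR_left_mono) auto
    then show ?thesis
      using q_scale_le[OF k x] k by (intro antisym) auto
  qed
  have split: "x = pprt x - pprt (- x)" for x :: 'a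
    using prts[of x] by (simp add: pprt_neg)
  have p_diff: "p (u - v) = q u - q v" if uv: "0 \<le> u" "0 \<le> v" for u v
  proof -
    let ?x = "u - v"
    have "pprt ?x + v = u + pprt (- ?x)"
      using split[of ?x] by (simp add: algebra_simps)
    then have "q (pprt ?x) + q v = q u + q (pprt (- ?x))"
      using uv q_add by (metis zero_le_pprt)
    then show ?thesis
      unfolding p_def by (simp add: algebra_simps)
  qed
  have p_pos: "p x = q x" if "0 \<le> x" for x
    using p_diff[of x 0] that q0 by simp
  have p_add: "p (x + y) = p x + p y" for x y
  proof -
    have "x + y = (pprt x + pprt y) - (pprt (- x) + pprt (- y))"
      using arg_cong2[OF split[of x] split[of y], of "(+)"] by (simp only: add_diff_add)
    then have "p (x + y) = q (pprt x + pprt y) - q (pprt (- x) + pprt (- y))"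
      using p_diff by (metis add_nonneg_nonneg zero_le_pprt)
    then show ?thesis
      by (simp add: q_add p_def)
  qed
  have p_minus: "p (- x) = - p x" for x
    by (simp add: p_def)
  have p_scale_nonneg: "p (k *\<^sub>R x) = k *\<^sub>R p x" if k: "0 \<le> k" for k x
  proof -
    have "k *\<^sub>R x = k *\<^sub>R pprt x - k *\<^sub>R pprt (- x)"
      using split[of x] by (metis scaleR_right_diff_distrib)
    then have "p (k *\<^sub>R x) = q (k *\<^sub>R pprt x) - q (k *\<^sub>R pprt (- x))"
      using p_diff k by (metis scaleR_nonneg_nonneg zero_le_pprt)
    then show ?thesis
      using k by (simp add: q_scale p_def scaleR_right_diff_distrib)
  qed
  have p_scale: "p (k *\<^sub>R x) = k *\<^sub>R p x" for k x
  proof (cases "0 \<le> k")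
    case False
    then have "p ((- k) *\<^sub>R x) = (- k) *\<^sub>R p x" by (intro p_scale_nonneg) simp
    then show ?thesis using p_minus[of "k *\<^sub>R x"] by simp
  qed (rule p_scale_nonneg)
  have lin: "linear p"
    by (simp add: linear_iff p_add p_scale)
  have mono: "p x \<le> p y" if "x \<le> y" for x y
  proof -
    have "0 \<le> p (y - x)" using that q_nonneg p_pos by simp
    then show ?thesis using lin by (simp add: linear_diff)
  qed
  have "p ` {a..b} \<subseteq> {p a..p b}" for a b
    using mono by auto
  then have "order_bounded p"
    unfolding order_bounded_def by blast
  then show ?thesis
    using lin p_pos q_def by auto
qed

lift_definition pos_part_op ::
    "'a::dedekind_complete_vector_lattice ob_operator \<Rightarrow> 'a ob_operator"
  is "\<lambda>h. SOME p. linear p \<and> order_bounded p \<and> (\<forall>x\<ge>0. p x = Sup (h ` {0..x}))"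
  using someI_ex[OF riesz_kantorovich] by blast

lemma apply_pos_part_op:
  assumes "0 \<le> x"
  shows "apply_op (pos_part_op T) x = Sup (apply_op T ` {0..x})"
  using someI_ex[OF riesz_kantorovich[OF linear_apply_op order_bounded_apply_op, of T]] assms
  unfolding pos_part_op.rep_eq by blast

lemma
  shows pos_part_op_nonneg: "0 \<le> pos_part_op T"
    and pos_part_op_ge: "T \<le> pos_part_op T"
    and pos_part_op_least: "0 \<le> U \<Longrightarrow> T \<le> U \<Longrightarrow> pos_part_op T \<le> U"
proof -
  have upper: "apply_op T y \<le> apply_op (pos_part_op T) x" if "0 \<le> y" "y \<le> x" for x y
  proof -
    obtain c d where "apply_op T ` {0..x} \<subseteq> {c..d}"
      using order_bounded_apply_op[of T] unfolding order_bounded_def by meson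
    then have "bdd_above (apply_op T ` {0..x})" by (rule bdd_above_mono[OF bdd_above_Icc])
    then show ?thesis
      using that by (subst apply_pos_part_op) (auto intro!: cSup_upper intro: order_trans)
  qed
  show "T \<le> pos_part_op T"
    using upper by (simp add: less_eq_ob_operator.rep_eq)
  show "0 \<le> pos_part_op T"
    using upper[of 0] linear_0[OF linear_apply_op[of T]]
    by (simp add: less_eq_ob_operator.rep_eq zero_ob_operator.rep_eq)
  show "pos_part_op T \<le> U" if U: "0 \<le> U" "T \<le> U"
    unfolding less_eq_ob_operator.rep_eq
  proof (intro allI impI)
    fix x :: 'a assume x: "0 \<le> x"
    have "apply_op T y \<le> apply_op U x" if y: "0 \<le> y" "y \<le> x" for y
    proof -
      have "0 \<le> apply_op U (x - y)"
        using U(1) y by (simp add: less_eq_ob_operator.rep_eq zero_ob_operator.rep_eq)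
      then have "apply_op U y \<le> apply_op U x"
        by (simp add: linear_diff[OF linear_apply_op])
      moreover have "apply_op T y \<le> apply_op U y"
        using U(2) y by (simp add: less_eq_ob_operator.rep_eq)
      ultimately show ?thesis by (rule order_trans[rotated])
    qed
    then show "apply_op (pos_part_op T) x \<le> apply_op U x"
      unfolding apply_pos_part_op[OF x] using x by (intro cSup_least) auto
  qed
qed

instantiation ob_operator :: (dedekind_complete_vector_lattice) vector_lattice
begin

definition sup_ob_operator :: "'a ob_operator \<Rightarrow> 'a ob_operator \<Rightarrow> 'a ob_operator" where
  "sup S T = T + pos_part_op (S - T)"

definition inf_ob_operator :: "'a ob_operator \<Rightarrow> 'a ob_operator \<Rightarrow> 'a ob_operator" where
  "inf S T = S - pos_part_op (S - T)"

definition abs_ob_operator :: "'a ob_operator \<Rightarrow> 'a ob_operator" where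
  "\<bar>T\<bar> = sup T (- T :: 'a ob_operator)"

instance
proof
  fix S T U :: "'a ob_operator"
  let ?P = "pos_part_op (S - T)"
  show "inf S T \<le> S" "T \<le> sup S T"
    using pos_part_op_nonneg[of "S - T"] by (simp_all add: inf_ob_operator_def sup_ob_operator_def)
  show "inf S T \<le> T" "S \<le> sup S T"
    using pos_part_op_ge[of "S - T"]
    by (simp_all add: inf_ob_operator_def sup_ob_operator_def algebra_simps)
  show "U \<le> inf S T" if "U \<le> S" "U \<le> T"
    using that pos_part_op_least[of "S - U" "S - T"]
    by (simp add: inf_ob_operator_def algebra_simps)
  show "sup T U \<le> S" if "T \<le> S" "U \<le> S"
    using that pos_part_op_least[of "S - U" "T - U"]
    by (simp add: sup_ob_operator_def algebra_simps)
  show "\<bar>T\<bar> = sup T (- T)" by (rule abs_ob_operator_def)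
qed

end


section \<open>Order continuous operators\<close>

text \<open>
  Order continuity refers to nets with arbitrary index sets, which a definition cannot
  quantify over. Index sets inside \<open>'a \<times> 'a\<close> suffice: see \<open>order_continuous_opD\<close> below.
\<close>

definition order_continuous_ops ::
    "'a::dedekind_complete_vector_lattice ob_operator set" where
  "order_continuous_ops = {T. \<forall>(A :: ('a \<times> 'a) set) r x.
     directed_set A r \<longrightarrow> order_convergent A r x 0 \<longrightarrow>
     order_convergent A r (\<lambda>a. apply_op T (x a)) 0}"

lemma order_continuous_opD:
  fixes A :: "'i set" and x :: "'i \<Rightarrow> 'a::dedekind_complete_vector_lattice"
  assumes T: "T \<in> order_continuous_ops" and A: "directed_set A r"
    and x: "order_convergent A r x 0"
  shows "order_convergent A r (\<lambda>a. apply_op T (x a)) 0"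
proof -
  obtain B :: "'a set" and s and y :: "'a \<Rightarrow> 'a"
    where B: "directed_set B s" and y: "decreases_to_zero B s y"
      and dom: "\<forall>b\<in>B. \<exists>a\<^sub>0\<in>A. \<forall>a\<in>A. (a\<^sub>0, a) \<in> r \<longrightarrow> \<bar>0 - x a\<bar> \<le> y b"
    using x unfolding order_convergent_def by blast
  let ?C = "{(b, u). b \<in> B \<and> \<bar>u\<bar> \<le> y b}"
  let ?t = "{(c, d). c \<in> ?C \<and> d \<in> ?C \<and> (fst c, fst d) \<in> s}"
  have zero: "(b, 0) \<in> ?C" if "b \<in> B" for b
    using that y unfolding decreases_to_zero_def by auto
  have Cne: "?C \<noteq> {}"
    using zero B unfolding directed_set_def by blast
  have Cpre: "preorder_on ?C ?t"
    using B unfolding directed_set_def preorder_on_def refl_on_def trans_def by auto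
  have Cdir: "\<exists>w\<in>?C. (c, w) \<in> ?t \<and> (d, w) \<in> ?t" if "c \<in> ?C" "d \<in> ?C" for c d
  proof -
    have "fst c \<in> B" "fst d \<in> B" using that by auto
    then obtain e where e: "e \<in> B" "(fst c, e) \<in> s" "(fst d, e) \<in> s"
      using B unfolding directed_set_def by blast
    show ?thesis
      using that e zero[OF e(1)] by (intro bexI[of _ "(e, 0)"]) auto
  qed
  have C: "directed_set ?C ?t"
    unfolding directed_set_def using Cne Cpre Cdir by blast
  have "\<exists>c\<in>?C. \<forall>d\<in>?C. (c, d) \<in> ?t \<longrightarrow> \<bar>0 - snd d\<bar> \<le> y b" if b: "b \<in> B" for b
  proof (rule bexI[OF _ zero[OF b]], intro ballI impI)
    fix d assume "d \<in> ?C" "((b, 0), d) \<in> ?t"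
    then have "\<bar>snd d\<bar> \<le> y (fst d)" "y (fst d) \<le> y b"
      using y b unfolding decreases_to_zero_def by auto
    then show "\<bar>0 - snd d\<bar> \<le> y b" by (auto intro: order_trans)
  qed
  then have "order_convergent ?C ?t snd 0"
    by (rule order_convergentI[OF B y])
  with T C have "order_convergent ?C ?t (\<lambda>c. apply_op T (snd c)) 0"
    unfolding order_continuous_ops_def by blast
  then obtain D :: "'a set" and u and z :: "'a \<Rightarrow> 'a"
    where D: "directed_set D u" and z: "decreases_to_zero D u z"
      and dom': "\<forall>d\<in>D. \<exists>c\<in>?C. \<forall>e\<in>?C. (c, e) \<in> ?t \<longrightarrow> \<bar>0 - apply_op T (snd e)\<bar> \<le> z d"
    unfolding order_convergent_def by blast
  show ?thesis
  proof (rule order_convergentI[OF D z])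
    fix d assume "d \<in> D"
    then obtain c where c: "c \<in> ?C"
      and c': "\<forall>e\<in>?C. (c, e) \<in> ?t \<longrightarrow> \<bar>0 - apply_op T (snd e)\<bar> \<le> z d"
      using dom' by blast
    have cB: "fst c \<in> B" using c by auto
    then have cc: "(fst c, fst c) \<in> s"
      using B unfolding directed_set_def preorder_on_def refl_on_def by blast
    obtain a\<^sub>0 where a0: "a\<^sub>0 \<in> A"
      and le: "\<forall>a\<in>A. (a\<^sub>0, a) \<in> r \<longrightarrow> \<bar>0 - x a\<bar> \<le> y (fst c)"
      using dom cB by blast
    have "\<bar>0 - apply_op T (x a)\<bar> \<le> z d" if a: "a \<in> A" "(a\<^sub>0, a) \<in> r" for a
    proof -
      have "(fst c, x a) \<in> ?C" using le a cB by auto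
      moreover from this have "(c, (fst c, x a)) \<in> ?t" using c cc by auto
      ultimately have "\<bar>0 - apply_op T (snd (fst c, x a))\<bar> \<le> z d"
        using c' by blast
      then show ?thesis by simp
    qed
    then show "\<exists>a\<^sub>0\<in>A. \<forall>a\<in>A. (a\<^sub>0, a) \<in> r \<longrightarrow> \<bar>0 - apply_op T (x a)\<bar> \<le> z d"
      using a0 by blast
  qed
qed

end

theory Submission
  imports Defs
begin

text \<open>
  Everything rests on the estimate
  \<open>\<bar>S\<^sub>0 T\<^sub>0 - S\<^sub>\<alpha> T\<^sub>\<beta>\<bar> \<le> \<bar>S\<^sub>0 - S\<^sub>\<alpha>\<bar> \<bar>T\<^sub>\<beta>\<bar> + \<bar>S\<^sub>0\<bar> \<bar>T\<^sub>0 - T\<^sub>\<beta>\<bar>\<close>. If \<open>U\<^sub>i \<down> 0\<close> and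
  \<open>V\<^sub>j \<down> 0\<close> dominate the two given nets and \<open>k\<close> is a fixed index of the second one, then eventually
  \<open>\<bar>T\<^sub>\<beta>\<bar> \<le> W\<close> with \<open>W = \<bar>T\<^sub>0\<bar> + V\<^sub>k\<close>, so the products are dominated by the net
  \<open>U\<^sub>i W + \<bar>S\<^sub>0\<bar> V\<^sub>j\<close>, and the task is to see that this net decreases to zero.

  For a decreasing net of operators, decreasing to zero is a pointwise matter on the positive cone
  (\<open>decreases_to_zero_op_iff\<close>), because the pointwise infimum is additive and hence extends to a
  positive operator. At \<open>x \<ge> 0\<close> the first summand is \<open>U\<^sub>i\<close> at the fixed positive vector \<open>W x\<close>, so it
  decreases to zero without any continuity. In the second summand \<open>\<bar>S\<^sub>0\<bar>\<close> is applied to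
  \<open>V\<^sub>j x \<down> 0\<close>, and this is where order continuity enters: \<open>\<bar>S\<^sub>0\<bar>\<close> must preserve decrease to
  zero.

  The modulus of an order continuous operator preserves decrease to zero
  (\<open>decreases_to_zero_abs_op\<close>), and conversely an operator whose modulus does so is order
  continuous (\<open>order_continuous_opI\<close>). The property passes to the order limit \<open>S\<^sub>0\<close> since
  \<open>\<bar>S\<^sub>0\<bar> \<le> \<bar>S\<^sub>\<alpha>\<bar> + U\<^sub>i\<close> for suitable \<open>\<alpha>\<close>, where \<open>\<bar>S\<^sub>\<alpha>\<bar>\<close> is order continuous and \<open>U\<^sub>i\<close> is small
  (\<open>order_continuous_ops_limit\<close>).
\<close>


section \<open>Directed sets and nets decreasing to zero\<close>

lemma directed_set_refl:
  assumes "directed_set A r" "a \<in> A"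
  shows "(a, a) \<in> r"
  using assms unfolding directed_set_def preorder_on_def refl_on_def by blast

lemma directed_set_upper:
  assumes "directed_set A r" "a \<in> A" "b \<in> A"
  obtains c where "c \<in> A" "(a, c) \<in> r" "(b, c) \<in> r"
  using assms unfolding directed_set_def by blast

lemma directed_set_trans:
  assumes "directed_set A r" "(a, b) \<in> r" "(b, c) \<in> r"
  shows "(a, c) \<in> r"
  using assms unfolding directed_set_def preorder_on_def trans_def by blast

lemma directed_set_product:
  assumes A: "directed_set A r" and B: "directed_set B s"
  shows "directed_set (A \<times> B) (product_order r s)"
proof -
  have "preorder_on (A \<times> B) (product_order r s)"
    using A B unfolding directed_set_def preorder_on_def refl_on_def trans_def product_order_def
    by (auto 0 3)
  moreover have "\<exists>w\<in>A \<times> B. (u, w) \<in> product_order r s \<and> (v, w) \<in> product_order r s"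
    if "u \<in> A \<times> B" "v \<in> A \<times> B" for u v
  proof -
    from that obtain a b a' b' where uv: "u = (a, b)" "v = (a', b')"
      and "a \<in> A" "a' \<in> A" "b \<in> B" "b' \<in> B"
      by blast
    then obtain c d where "c \<in> A" "(a, c) \<in> r" "(a', c) \<in> r" "d \<in> B" "(b, d) \<in> s" "(b', d) \<in> s"
      using A B by (metis directed_set_upper)
    then show ?thesis
      unfolding uv product_order_def by (intro bexI[of _ "(c, d)"]) auto
  qed
  moreover have "A \<times> B \<noteq> {}"
    using A B unfolding directed_set_def by blast
  ultimately show ?thesis
    unfolding directed_set_def by blast
qed

lemma decreases_to_zeroI:
  assumes "\<And>b c. b \<in> B \<Longrightarrow> c \<in> B \<Longrightarrow> (b, c) \<in> s \<Longrightarrow> y c \<le> y b"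
    and "\<And>b. b \<in> B \<Longrightarrow> 0 \<le> y b"
    and "\<And>z. (\<And>b. b \<in> B \<Longrightarrow> z \<le> y b) \<Longrightarrow> z \<le> 0"
  shows "decreases_to_zero B s y"
  using assms unfolding decreases_to_zero_def by blast

lemma
  assumes "decreases_to_zero B s y"
  shows decreases_to_zero_mono: "b \<in> B \<Longrightarrow> c \<in> B \<Longrightarrow> (b, c) \<in> s \<Longrightarrow> y c \<le> y b"
    and decreases_to_zero_nonneg: "b \<in> B \<Longrightarrow> 0 \<le> y b"
    and decreases_to_zero_lower: "(\<And>b. b \<in> B \<Longrightarrow> z \<le> y b) \<Longrightarrow> z \<le> 0"
  using assms unfolding decreases_to_zero_def by blast+

lemma decreases_to_zero_lower_add:
  assumes "decreases_to_zero B s y" "\<And>b. b \<in> B \<Longrightarrow> z \<le> c + y b"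
  shows "z \<le> c"
proof -
  have "z - c \<le> 0"
    using assms(2) by (intro decreases_to_zero_lower[OF assms(1)]) (simp add: diff_le_eq add.commute)
  then show ?thesis by simp
qed

lemma decreases_to_zero_add_product:
  assumes y: "decreases_to_zero I r y" and z: "decreases_to_zero J s z"
  shows "decreases_to_zero (I \<times> J) (product_order r s) (\<lambda>(i, j). y i + z j)"
proof (rule decreases_to_zeroI)
  fix p q assume "p \<in> I \<times> J" "q \<in> I \<times> J" "(p, q) \<in> product_order r s"
  then show "(case q of (i, j) \<Rightarrow> y i + z j) \<le> (case p of (i, j) \<Rightarrow> y i + z j)"
    by (auto simp: product_order_def
        intro!: add_mono decreases_to_zero_mono[OF y] decreases_to_zero_mono[OF z])
next
  fix p assume "p \<in> I \<times> J"
  then show "0 \<le> (case p of (i, j) \<Rightarrow> y i + z j)"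
    by (auto intro!: add_nonneg_nonneg decreases_to_zero_nonneg[OF y] decreases_to_zero_nonneg[OF z])
next
  fix w assume w: "\<And>p. p \<in> I \<times> J \<Longrightarrow> w \<le> (case p of (i, j) \<Rightarrow> y i + z j)"
  show "w \<le> 0"
  proof (rule decreases_to_zero_lower[OF y])
    fix i assume i: "i \<in> I"
    show "w \<le> y i"
    proof (rule decreases_to_zero_lower_add[OF z])
      fix j assume "j \<in> J"
      then show "w \<le> y i + z j"
        using w[of "(i, j)"] i by simp
    qed
  qed
qed

text \<open>
  By directedness, the diagonal of the product index set is cofinal, which reduces the sum over one
  index to the sum over two independent ones.
\<close>

lemma decreases_to_zero_add:
  assumes B: "directed_set B s" and y: "decreases_to_zero B s y" and z: "decreases_to_zero B s z"
  shows "decreases_to_zero B s (\<lambda>b. y b + z b)"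
proof (rule decreases_to_zeroI)
  show "y c + z c \<le> y b + z b" if "b \<in> B" "c \<in> B" "(b, c) \<in> s" for b c
    using that by (intro add_mono decreases_to_zero_mono[OF y] decreases_to_zero_mono[OF z])
  show "0 \<le> y b + z b" if "b \<in> B" for b
    using that by (intro add_nonneg_nonneg decreases_to_zero_nonneg[OF y] decreases_to_zero_nonneg[OF z])
  fix w assume w: "\<And>b. b \<in> B \<Longrightarrow> w \<le> y b + z b"
  show "w \<le> 0"
  proof (rule decreases_to_zero_lower[OF decreases_to_zero_add_product[OF y z]])
    fix p assume "p \<in> B \<times> B"
    then obtain b c where p: "p = (b, c)" and bc: "b \<in> B" "c \<in> B" by blast
    then obtain d where d: "d \<in> B" "(b, d) \<in> s" "(c, d) \<in> s"
      using B by (metis directed_set_upper)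
    then have "y d + z d \<le> y b + z c"
      using bc by (intro add_mono decreases_to_zero_mono[OF y] decreases_to_zero_mono[OF z])
    then show "w \<le> (case p of (i, j) \<Rightarrow> y i + z j)"
      using w[OF d(1)] p by (auto intro: order_trans)
  qed
qed

lemma decreases_to_zero_inf:
  fixes v :: "'a::vector_lattice"
  assumes y: "decreases_to_zero B s y" and v: "0 \<le> v"
  shows "decreases_to_zero B s (\<lambda>c. inf v (y c))"
proof (rule decreases_to_zeroI)
  fix c d assume "c \<in> B" "d \<in> B" "(c, d) \<in> s"
  then show "inf v (y d) \<le> inf v (y c)"
    by (intro inf_mono decreases_to_zero_mono[OF y]) auto
next
  fix c assume "c \<in> B"
  then show "0 \<le> inf v (y c)"
    using v decreases_to_zero_nonneg[OF y] by simp
next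
  fix z assume "\<And>c. c \<in> B \<Longrightarrow> z \<le> inf v (y c)"
  then show "z \<le> 0"
    by (intro decreases_to_zero_lower[OF y]) (blast intro: order_trans inf_le2)
qed

lemma decreases_to_zero_imp_order_convergent:
  assumes B: "directed_set B s" and y: "decreases_to_zero B s y"
  shows "order_convergent B s y 0"
proof (rule order_convergentI[OF B y])
  fix b assume b: "b \<in> B"
  have "\<bar>0 - y c\<bar> \<le> y b" if "c \<in> B" "(b, c) \<in> s" for c
    using decreases_to_zero_mono[OF y b that] decreases_to_zero_nonneg[OF y that(1)] by simp
  then show "\<exists>a\<^sub>0\<in>B. \<forall>a\<in>B. (a\<^sub>0, a) \<in> s \<longrightarrow> \<bar>0 - y a\<bar> \<le> y b"
    using b by blast
qed

text \<open>
  Inequalities that hold on a tail pass to the limit: that tail meets every tail on which a term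
  of the dominating net bounds \<open>x\<close>.
\<close>

lemma order_convergent_zero_lower_add:
  assumes A: "directed_set A r" and x: "order_convergent A r x 0" and a: "a \<in> A"
    and le: "\<And>b. b \<in> A \<Longrightarrow> (a, b) \<in> r \<Longrightarrow> z \<le> c + x b"
  shows "z \<le> c"
proof -
  obtain B :: "'b set" and s and y :: "'b \<Rightarrow> 'b" where y: "decreases_to_zero B s y"
    and dom: "\<forall>b\<in>B. \<exists>a\<^sub>0\<in>A. \<forall>a\<in>A. (a\<^sub>0, a) \<in> r \<longrightarrow> \<bar>0 - x a\<bar> \<le> y b"
    using x unfolding order_convergent_def by blast
  show ?thesis
  proof (rule decreases_to_zero_lower_add[OF y])
    fix b assume "b \<in> B"
    then obtain a\<^sub>0 where a0: "a\<^sub>0 \<in> A" "\<forall>a\<in>A. (a\<^sub>0, a) \<in> r \<longrightarrow> \<bar>0 - x a\<bar> \<le> y b"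
      using dom by blast
    obtain d where d: "d \<in> A" "(a\<^sub>0, d) \<in> r" "(a, d) \<in> r"
      using directed_set_upper[OF A a0(1) a] .
    have "x d \<le> \<bar>0 - x d\<bar>" using abs_ge_self[of "x d"] by simp
    also have "\<dots> \<le> y b" using a0 d by blast
    finally have "c + x d \<le> c + y b" by simp
    then show "z \<le> c + y b" using le[OF d(1,3)] by (rule order_trans[rotated])
  qed
qed


section \<open>Order bounded operators and their moduli\<close>

lemmas op_eval = plus_ob_operator.rep_eq minus_ob_operator.rep_eq uminus_ob_operator.rep_eq
  zero_ob_operator.rep_eq comp_op.rep_eq

lemmas op_add = linear_add[OF linear_apply_op]
  and op_diff = linear_diff[OF linear_apply_op]

lemma ob_operator_leD: "S \<le> T \<Longrightarrow> 0 \<le> x \<Longrightarrow> apply_op S x \<le> apply_op T x"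
  by (simp add: less_eq_ob_operator.rep_eq)

lemma ob_operator_leI: "(\<And>x. 0 \<le> x \<Longrightarrow> apply_op S x \<le> apply_op T x) \<Longrightarrow> S \<le> T"
  by (simp add: less_eq_ob_operator.rep_eq)

lemma positive_op_nonneg: "0 \<le> S \<Longrightarrow> 0 \<le> x \<Longrightarrow> 0 \<le> apply_op S x"
  using ob_operator_leD[of 0 S x] by (simp add: op_eval)

lemma positive_op_mono:
  assumes "0 \<le> S" "x \<le> y"
  shows "apply_op S x \<le> apply_op S y"
  using positive_op_nonneg[OF assms(1), of "y - x"] assms(2) by (simp add: op_diff)

lemma abs_apply_op_le: "\<bar>apply_op T x\<bar> \<le> apply_op \<bar>T\<bar> \<bar>x\<bar>"
proof -
  have *: "apply_op S x \<le> apply_op \<bar>T\<bar> \<bar>x\<bar>" if S: "S \<le> \<bar>T\<bar>" "- S \<le> \<bar>T\<bar>" for S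
  proof -
    have x: "x = pprt x - pprt (- x)" and ax: "\<bar>x\<bar> = pprt x + pprt (- x)"
      using prts[of x] abs_prts[of x] by (simp_all add: pprt_neg)
    have "apply_op S (pprt x) \<le> apply_op \<bar>T\<bar> (pprt x)"
      "- apply_op S (pprt (- x)) \<le> apply_op \<bar>T\<bar> (pprt (- x))"
      using ob_operator_leD[OF S(1), of "pprt x"] ob_operator_leD[OF S(2), of "pprt (- x)"]
      by (simp_all add: op_eval)
    then have "apply_op S (pprt x) - apply_op S (pprt (- x))
        \<le> apply_op \<bar>T\<bar> (pprt x) + apply_op \<bar>T\<bar> (pprt (- x))"
      by (simp only: diff_conv_add_uminus add_mono)
    then show ?thesis
      by (metis x ax op_add op_diff)
  qed
  show ?thesis
    using *[of T] *[of "- T"] by (intro abs_leI) (simp_all add: op_eval abs_ge_self abs_ge_minus_self)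
qed

lemma abs_comp_op_le: "\<bar>S \<cdot> T\<bar> \<le> \<bar>S\<bar> \<cdot> \<bar>T\<bar>"
proof -
  have *: "\<bar>apply_op (S \<cdot> T) x\<bar> \<le> apply_op (\<bar>S\<bar> \<cdot> \<bar>T\<bar>) x" if x: "0 \<le> x" for x
  proof -
    have "\<bar>apply_op (S \<cdot> T) x\<bar> \<le> apply_op \<bar>S\<bar> \<bar>apply_op T x\<bar>"
      by (simp add: op_eval abs_apply_op_le)
    also have "\<dots> \<le> apply_op \<bar>S\<bar> (apply_op \<bar>T\<bar> x)"
      using abs_apply_op_le[of T x] x by (intro positive_op_mono) auto
    finally show ?thesis by (simp add: op_eval)
  qed
  show ?thesis
    using * by (intro abs_leI ob_operator_leI) (auto simp: op_eval dest: abs_le_D1 abs_le_D2)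
qed

lemma comp_op_mono:
  assumes "S \<le> S'" "T \<le> T'" "0 \<le> S" "0 \<le> T'"
  shows "S \<cdot> T \<le> S' \<cdot> T'"
proof (rule ob_operator_leI)
  fix x :: 'a assume x: "0 \<le> x"
  have "apply_op S (apply_op T x) \<le> apply_op S (apply_op T' x)"
    using assms x by (intro positive_op_mono ob_operator_leD)
  also have "\<dots> \<le> apply_op S' (apply_op T' x)"
    using assms x by (intro ob_operator_leD positive_op_nonneg)
  finally show "apply_op (S \<cdot> T) x \<le> apply_op (S' \<cdot> T') x"
    by (simp add: op_eval)
qed

lemma comp_op_diff_eq: "S \<cdot> T - S' \<cdot> T' = (S - S') \<cdot> T' + S \<cdot> (T - T')"
  by (simp add: apply_op_inject[symmetric] op_eval fun_eq_iff op_diff)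


section \<open>Pointwise infima of operators\<close>

text \<open>
  Kantorovich's extension: every vector is a difference of positive ones, and additivity makes the
  value independent of the chosen difference. Order boundedness comes from monotonicity.
\<close>

lemma positive_op_extension:
  fixes q :: "'a::dedekind_complete_vector_lattice \<Rightarrow> 'a"
  assumes add: "\<And>x y. 0 \<le> x \<Longrightarrow> 0 \<le> y \<Longrightarrow> q (x + y) = q x + q y"
    and scale: "\<And>k x. 0 \<le> k \<Longrightarrow> 0 \<le> x \<Longrightarrow> q (k *\<^sub>R x) = k *\<^sub>R q x"
    and nonneg: "\<And>x. 0 \<le> x \<Longrightarrow> 0 \<le> q x"
  obtains P where "\<And>x. 0 \<le> x \<Longrightarrow> apply_op P x = q x"
proof -
  define p where "p x = q (pprt x) - q (pprt (- x))" for x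
  have split: "x = pprt x - pprt (- x)" for x :: 'a
    using prts[of x] by (simp add: pprt_neg)
  have p_diff: "p (u - v) = q u - q v" if uv: "0 \<le> u" "0 \<le> v" for u v
  proof -
    have "pprt (u - v) + v = u + pprt (- (u - v))"
      using split[of "u - v"] by (simp add: algebra_simps)
    then have "q (pprt (u - v)) + q v = q u + q (pprt (- (u - v)))"
      using uv add by (metis zero_le_pprt)
    then show ?thesis
      unfolding p_def by (simp add: algebra_simps)
  qed
  have p_pos: "p x = q x" if "0 \<le> x" for x
    using p_diff[of x 0] that add[of 0 0] by simp
  have p_add: "p (x + y) = p x + p y" for x y
  proof -
    have "x + y = (pprt x + pprt y) - (pprt (- x) + pprt (- y))"
      using arg_cong2[OF split[of x] split[of y], of "(+)"] by (simp only: add_diff_add)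
    then have "p (x + y) = q (pprt x + pprt y) - q (pprt (- x) + pprt (- y))"
      using p_diff by (metis add_nonneg_nonneg zero_le_pprt)
    then show ?thesis
      by (simp add: add p_def)
  qed
  have p_scale_nonneg: "p (k *\<^sub>R x) = k *\<^sub>R p x" if k: "0 \<le> k" for k x
  proof -
    have "k *\<^sub>R x = k *\<^sub>R pprt x - k *\<^sub>R pprt (- x)"
      using split[of x] by (metis scaleR_right_diff_distrib)
    then have "p (k *\<^sub>R x) = q (k *\<^sub>R pprt x) - q (k *\<^sub>R pprt (- x))"
      using p_diff k by (metis scaleR_nonneg_nonneg zero_le_pprt)
    then show ?thesis
      using k by (simp add: scale p_def scaleR_right_diff_distrib)
  qed
  have p_minus: "p (- x) = - p x" for x
    by (simp add: p_def)
  have "p (k *\<^sub>R x) = k *\<^sub>R p x" for k x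
    using p_scale_nonneg[of k x] p_scale_nonneg[of "- k" x] p_minus[of "k *\<^sub>R x"]
    by (cases "0 \<le> k") auto
  then have lin: "linear p"
    by (simp add: linear_iff p_add)
  have "p x \<le> p y" if "x \<le> y" for x y
  proof -
    have "0 \<le> p y - p x"
      using nonneg[of "y - x"] p_pos[of "y - x"] that lin by (simp add: linear_diff)
    then show ?thesis by simp
  qed
  then have "p ` {a..b} \<subseteq> {p a..p b}" for a b
    by auto
  then have "order_bounded p"
    unfolding order_bounded_def by blast
  with lin have "apply_op (Abs_ob_operator p) = p"
    by (simp add: Abs_ob_operator_inverse)
  with p_pos show ?thesis
    by (intro that[of "Abs_ob_operator p"]) simp
qed

text \<open>
  The infimum of a decreasing net of operators is computed pointwise. The pointwise infimum is
  additive because of directedness, as \<open>U\<^sub>k (x + y) \<le> U\<^sub>i x + U\<^sub>j y\<close> for \<open>k\<close> beyond \<open>i\<close> and \<open>j\<close>. It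
  therefore extends to an operator below all \<open>U\<^sub>i\<close>, which has to be below zero.
\<close>

lemma decreases_to_zero_apply_op:
  fixes U :: "'i \<Rightarrow> 'a::dedekind_complete_vector_lattice ob_operator"
  assumes I: "directed_set I s" and U: "decreases_to_zero I s U" and x: "0 \<le> x"
  shows "decreases_to_zero I s (\<lambda>i. apply_op (U i) x)"
proof (rule decreases_to_zeroI)
  show "apply_op (U j) x \<le> apply_op (U i) x" if "i \<in> I" "j \<in> I" "(i, j) \<in> s" for i j
    using ob_operator_leD[OF decreases_to_zero_mono[OF U that] x] .
  show "0 \<le> apply_op (U i) x" if "i \<in> I" for i
    using positive_op_nonneg[OF decreases_to_zero_nonneg[OF U that] x] .
next
  fix z assume z: "\<And>i. i \<in> I \<Longrightarrow> z \<le> apply_op (U i) x"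
  have ne: "I \<noteq> {}" using I unfolding directed_set_def by blast
  define q where "q y = (INF i\<in>I. apply_op (U i) y)" for y
  have lower: "q y \<le> apply_op (U i) y" if "0 \<le> y" "i \<in> I" for y i
    unfolding q_def
  proof (rule cINF_lower)
    show "bdd_below ((\<lambda>i. apply_op (U i) y) ` I)"
      using that(1) by (intro bdd_belowI2[of _ 0] positive_op_nonneg decreases_to_zero_nonneg[OF U])
  qed (use that in simp)
  have greatest: "w \<le> q y" if "\<And>i. i \<in> I \<Longrightarrow> w \<le> apply_op (U i) y" for w y
    unfolding q_def by (rule cINF_greatest[OF ne that])
  have add: "q (y + y') = q y + q y'" if y: "0 \<le> y" "0 \<le> y'" for y y'
  proof (rule antisym)
    have "q (y + y') \<le> apply_op (U i) y + apply_op (U j) y'" if ij: "i \<in> I" "j \<in> I" for i j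
    proof -
      obtain k where k: "k \<in> I" "(i, k) \<in> s" "(j, k) \<in> s"
        using directed_set_upper[OF I ij] .
      have "q (y + y') \<le> apply_op (U k) y + apply_op (U k) y'"
        using lower[of "y + y'" k] y k by (simp add: op_add)
      also have "\<dots> \<le> apply_op (U i) y + apply_op (U j) y'"
        using y k ij by (intro add_mono ob_operator_leD decreases_to_zero_mono[OF U])
      finally show ?thesis .
    qed
    then have "q (y + y') - apply_op (U i) y \<le> q y'" if "i \<in> I" for i
      using that by (intro greatest) (simp add: diff_le_eq add.commute[of "apply_op (U _) y'"])
    then have "q (y + y') - q y' \<le> q y"
      by (intro greatest) (simp add: diff_le_eq add.commute)
    then show "q (y + y') \<le> q y + q y'"
      by (simp add: diff_le_eq)
    show "q y + q y' \<le> q (y + y')"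
      using y by (intro greatest) (simp add: op_add add_mono lower)
  qed
  have scale_ge: "k *\<^sub>R q y \<le> q (k *\<^sub>R y)" if "0 \<le> k" "0 \<le> y" for k y
    using that
    by (intro greatest) (simp add: linear_cmul[OF linear_apply_op] scaleR_left_mono lower)
  have scale: "q (k *\<^sub>R y) = k *\<^sub>R q y" if k: "0 \<le> k" and y: "0 \<le> y" for k y
  proof (cases "k = 0")
    case True
    then show ?thesis using add[of 0 0] by simp
  next
    case False
    have "k *\<^sub>R (inverse k *\<^sub>R q (k *\<^sub>R y)) \<le> k *\<^sub>R q (inverse k *\<^sub>R (k *\<^sub>R y))"
      using k y by (intro scaleR_left_mono scale_ge) (simp_all add: scaleR_nonneg_nonneg)
    then show ?thesis
      using False scale_ge[OF k y] by (intro antisym) auto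
  qed
  have nonneg: "0 \<le> q y" if "0 \<le> y" for y
    using that by (intro greatest positive_op_nonneg decreases_to_zero_nonneg[OF U])
  obtain P where P: "\<And>y. 0 \<le> y \<Longrightarrow> apply_op P y = q y"
    using positive_op_extension[OF add scale nonneg] by blast
  have "P \<le> 0"
    by (intro decreases_to_zero_lower[OF U] ob_operator_leI) (simp add: P lower)
  then have "q x \<le> 0"
    using ob_operator_leD[of P 0 x] P[OF x] x by (simp add: op_eval)
  with greatest[of z x] z show "z \<le> 0"
    by (meson order_trans)
qed

lemma decreases_to_zero_op_iff:
  fixes U :: "'i \<Rightarrow> 'a::dedekind_complete_vector_lattice ob_operator"
  assumes I: "directed_set I s"
  shows "decreases_to_zero I s U \<longleftrightarrow> (\<forall>x\<ge>0. decreases_to_zero I s (\<lambda>i. apply_op (U i) x))"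
proof (intro iffI allI impI)
  assume U: "\<forall>x\<ge>0. decreases_to_zero I s (\<lambda>i. apply_op (U i) x)"
  show "decreases_to_zero I s U"
  proof (rule decreases_to_zeroI)
    fix i j assume "i \<in> I" "j \<in> I" "(i, j) \<in> s"
    then show "U j \<le> U i"
      using U by (intro ob_operator_leI) (simp add: decreases_to_zero_def)
  next
    fix i assume "i \<in> I"
    then show "0 \<le> U i"
      using U by (intro ob_operator_leI) (simp add: op_eval decreases_to_zero_def)
  next
    fix Z assume Z: "\<And>i. i \<in> I \<Longrightarrow> Z \<le> U i"
    show "Z \<le> 0"
    proof (rule ob_operator_leI)
      fix x :: 'a assume x: "0 \<le> x"
      then show "apply_op Z x \<le> apply_op 0 x"
        using U Z unfolding op_eval
        by (intro decreases_to_zero_lower[of I s "\<lambda>i. apply_op (U i) x"] ob_operator_leD) auto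
    qed
  qed
qed (rule decreases_to_zero_apply_op[OF I])


section \<open>Order continuity and the modulus\<close>

lemma order_continuous_ops_uminus:
  assumes "T \<in> order_continuous_ops"
  shows "- T \<in> order_continuous_ops"
  using assms unfolding order_continuous_ops_def order_convergent_def
  by (simp add: op_eval)

text \<open>
  The positive part is a supremum over \<open>v \<in> [0, y b]\<close> of values \<open>T v\<close>. Splitting \<open>v\<close> into
  \<open>v - inf v (y c)\<close>, which lies in \<open>[0, y b - y c]\<close>, and \<open>inf v (y c)\<close> gives
  \<open>T v \<le> T\<^sup>+ (y b) - T\<^sup>+ (y c) + T (inf v (y c))\<close>. In the limit over \<open>c\<close> a lower bound \<open>z\<close> of
  the net \<open>T\<^sup>+ (y c)\<close> satisfies \<open>z \<le> T\<^sup>+ (y b) - T v\<close>, and the supremum over \<open>v\<close> leaves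
  \<open>z \<le> 0\<close>.
\<close>

lemma decreases_to_zero_pos_part_op:
  fixes y :: "'i \<Rightarrow> 'a::dedekind_complete_vector_lattice"
  assumes T: "T \<in> order_continuous_ops" and B: "directed_set B s" and y: "decreases_to_zero B s y"
  shows "decreases_to_zero B s (\<lambda>b. apply_op (pos_part_op T) (y b))"
proof (rule decreases_to_zeroI)
  let ?P = "pos_part_op T"
  note P = pos_part_op_nonneg[of T]
  show "apply_op ?P (y c) \<le> apply_op ?P (y b)" if "b \<in> B" "c \<in> B" "(b, c) \<in> s" for b c
    using positive_op_mono[OF P decreases_to_zero_mono[OF y that]] .
  show "0 \<le> apply_op ?P (y b)" if "b \<in> B" for b
    using positive_op_nonneg[OF P decreases_to_zero_nonneg[OF y that]] .
  fix z assume z: "\<And>b. b \<in> B \<Longrightarrow> z \<le> apply_op ?P (y b)"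
  obtain b where b: "b \<in> B" using B unfolding directed_set_def by blast
  have key: "z \<le> apply_op ?P (y b) - apply_op T v" if v: "0 \<le> v" "v \<le> y b" for v
  proof (rule order_convergent_zero_lower_add[OF B _ b])
    show "order_convergent B s (\<lambda>c. apply_op T (inf v (y c))) 0"
      using decreases_to_zero_inf[OF y v(1)]
      by (intro order_continuous_opD[OF T B] decreases_to_zero_imp_order_convergent[OF B])
    fix c assume c: "c \<in> B" "(b, c) \<in> s"
    define w where "w = inf v (y c)"
    have "v \<le> v + (y b - y c)"
      using decreases_to_zero_mono[OF y b c] by simp
    moreover have "v \<le> y c + (y b - y c)"
      using v(2) by simp
    ultimately have "v \<le> w + (y b - y c)"
      unfolding w_def by (simp add: add_inf_distrib_right)
    then have vw: "v - w \<le> y b - y c"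
      by (simp only: diff_le_eq add.commute)
    have w0: "0 \<le> v - w"
      unfolding diff_ge_0_iff_ge w_def by (rule inf_le1)
    have "apply_op T (v - w) \<le> apply_op ?P (v - w)"
      using ob_operator_leD[OF pos_part_op_ge w0] .
    also have "\<dots> \<le> apply_op ?P (y b - y c)"
      by (rule positive_op_mono[OF P vw])
    finally have "apply_op T v - apply_op T w \<le> apply_op ?P (y b) - apply_op ?P (y c)"
      by (simp add: op_diff)
    then have "apply_op ?P (y c) \<le> apply_op ?P (y b) - apply_op T v + apply_op T w"
      by (simp add: algebra_simps)
    then show "z \<le> apply_op ?P (y b) - apply_op T v + apply_op T (inf v (y c))"
      using z[OF c(1)] unfolding w_def by (rule order_trans[rotated])
  qed
  have yb: "0 \<le> y b" using decreases_to_zero_nonneg[OF y b] .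
  have "Sup (apply_op T ` {0..y b}) \<le> apply_op ?P (y b) - z"
    using yb key by (intro cSup_least) (auto simp: le_diff_eq add.commute)
  then show "z \<le> 0"
    unfolding apply_pos_part_op[OF yb] by simp
qed

text \<open>The modulus is the sum of the positive parts of \<open>T\<close> and \<open>- T\<close>, and both
  \<open>T\<close> and \<open>- T\<close> are order continuous.\<close>

lemma decreases_to_zero_abs_op:
  fixes y :: "'i \<Rightarrow> 'a::dedekind_complete_vector_lattice"
  assumes T: "T \<in> order_continuous_ops" and B: "directed_set B s" and y: "decreases_to_zero B s y"
  shows "decreases_to_zero B s (\<lambda>b. apply_op \<bar>T\<bar> (y b))"
proof -
  have "pprt S = pos_part_op S" for S :: "'a ob_operator"
    by (simp add: pprt_def sup_ob_operator_def)
  then have "\<bar>T\<bar> = pos_part_op T + pos_part_op (- T)"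
    using abs_prts[of T] pprt_neg[of T] by simp
  then show ?thesis
    using decreases_to_zero_add[OF B decreases_to_zero_pos_part_op[OF T B y]
        decreases_to_zero_pos_part_op[OF order_continuous_ops_uminus[OF T] B y]]
    by (simp add: op_eval)
qed

text \<open>
  If \<open>y\<close> dominates the net \<open>x\<close>, then \<open>\<bar>T\<bar> y\<close> dominates \<open>T x\<close>, since \<open>\<bar>T u\<bar> \<le> \<bar>T\<bar> \<bar>u\<bar>\<close>. Only
  nets indexed by subsets of the vector lattice itself occur in the hypothesis, as the dominating
  nets in \<^const>\<open>order_convergent\<close> have such index sets.
\<close>

lemma order_continuous_opI:
  fixes T :: "'a::dedekind_complete_vector_lattice ob_operator"
  assumes T: "\<And>(B :: 'a set) s y. directed_set B s \<Longrightarrow> decreases_to_zero B s y \<Longrightarrow>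
    decreases_to_zero B s (\<lambda>b. apply_op \<bar>T\<bar> (y b))"
  shows "T \<in> order_continuous_ops"
  unfolding order_continuous_ops_def
proof (intro CollectI allI impI)
  fix A :: "('a \<times> 'a) set" and r and x :: "'a \<times> 'a \<Rightarrow> 'a"
  assume "order_convergent A r x 0"
  then obtain B :: "'a set" and s and y :: "'a \<Rightarrow> 'a"
    where B: "directed_set B s" and y: "decreases_to_zero B s y"
      and dom: "\<forall>b\<in>B. \<exists>a\<^sub>0\<in>A. \<forall>a\<in>A. (a\<^sub>0, a) \<in> r \<longrightarrow> \<bar>0 - x a\<bar> \<le> y b"
    unfolding order_convergent_def by blast
  show "order_convergent A r (\<lambda>a. apply_op T (x a)) 0"
  proof (rule order_convergentI[OF B T[OF B y]])
    fix b assume "b \<in> B"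
    have "\<bar>0 - apply_op T (x a)\<bar> \<le> apply_op \<bar>T\<bar> (y b)" if "\<bar>0 - x a\<bar> \<le> y b" for a
    proof -
      have "apply_op \<bar>T\<bar> \<bar>x a\<bar> \<le> apply_op \<bar>T\<bar> (y b)"
        using that by (intro positive_op_mono) simp_all
      then show ?thesis
        using order_trans[OF abs_apply_op_le[of T "x a"]] by simp
    qed
    then show "\<exists>a\<^sub>0\<in>A. \<forall>a\<in>A. (a\<^sub>0, a) \<in> r \<longrightarrow> \<bar>0 - apply_op T (x a)\<bar> \<le> apply_op \<bar>T\<bar> (y b)"
      using dom \<open>b \<in> B\<close> by meson
  qed
qed

text \<open>
  If \<open>\<bar>S\<^sub>0 - S \<alpha>\<bar> \<le> U i\<close>, then \<open>\<bar>S\<^sub>0\<bar> (y c) \<le> \<bar>S \<alpha>\<bar> (y c) + U i (y b)\<close> for \<open>c\<close> beyond \<open>b\<close>: the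
  first term vanishes in the limit over \<open>c\<close> with \<open>\<alpha>\<close> fixed, and the second then vanishes in the
  limit over \<open>i\<close> with \<open>b\<close> fixed.
\<close>

lemma order_continuous_ops_limit:
  fixes S :: "'i \<Rightarrow> 'a::dedekind_complete_vector_lattice ob_operator"
  assumes A: "directed_set A r"
    and S: "\<And>\<alpha>. \<alpha> \<in> A \<Longrightarrow> S \<alpha> \<in> order_continuous_ops"
    and conv: "order_convergent A r S S\<^sub>0"
  shows "S\<^sub>0 \<in> order_continuous_ops"
proof (rule order_continuous_opI)
  obtain I :: "'a ob_operator set" and t U where I: "directed_set I t"
    and U: "decreases_to_zero I t U"
    and domU: "\<forall>i\<in>I. \<exists>a\<^sub>0\<in>A. \<forall>a\<in>A. (a\<^sub>0, a) \<in> r \<longrightarrow> \<bar>S\<^sub>0 - S a\<bar> \<le> U i"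
    using conv unfolding order_convergent_def by blast
  fix B :: "'a set" and s and y :: "'a \<Rightarrow> 'a"
  assume B: "directed_set B s" and y: "decreases_to_zero B s y"
  show "decreases_to_zero B s (\<lambda>b. apply_op \<bar>S\<^sub>0\<bar> (y b))"
  proof (rule decreases_to_zeroI)
    show "apply_op \<bar>S\<^sub>0\<bar> (y c) \<le> apply_op \<bar>S\<^sub>0\<bar> (y b)" if "b \<in> B" "c \<in> B" "(b, c) \<in> s" for b c
      using decreases_to_zero_mono[OF y that] by (intro positive_op_mono) simp_all
    show "0 \<le> apply_op \<bar>S\<^sub>0\<bar> (y b)" if "b \<in> B" for b
      using decreases_to_zero_nonneg[OF y that] by (intro positive_op_nonneg) simp_all
    fix z assume z: "\<And>b. b \<in> B \<Longrightarrow> z \<le> apply_op \<bar>S\<^sub>0\<bar> (y b)"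
    obtain b where b: "b \<in> B" using B unfolding directed_set_def by blast
    show "z \<le> 0"
    proof (rule decreases_to_zero_lower)
      show "decreases_to_zero I t (\<lambda>i. apply_op (U i) (y b))"
        using decreases_to_zero_apply_op[OF I U decreases_to_zero_nonneg[OF y b]] .
      fix i assume i: "i \<in> I"
      then obtain \<alpha> where \<alpha>: "\<alpha> \<in> A" "\<bar>S\<^sub>0 - S \<alpha>\<bar> \<le> U i"
        using domU directed_set_refl[OF A] by blast
      have "\<bar>S\<^sub>0\<bar> \<le> \<bar>S \<alpha>\<bar> + \<bar>S\<^sub>0 - S \<alpha>\<bar>"
        using abs_triangle_ineq[of "S \<alpha>" "S\<^sub>0 - S \<alpha>"] by simp
      also have "\<dots> \<le> \<bar>S \<alpha>\<bar> + U i"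
        using \<alpha>(2) by simp
      finally have le: "\<bar>S\<^sub>0\<bar> \<le> \<bar>S \<alpha>\<bar> + U i" .
      show "z \<le> apply_op (U i) (y b)"
      proof (rule order_convergent_zero_lower_add[OF B _ b])
        show "order_convergent B s (\<lambda>c. apply_op \<bar>S \<alpha>\<bar> (y c)) 0"
          using decreases_to_zero_abs_op[OF S[OF \<alpha>(1)] B y]
          by (rule decreases_to_zero_imp_order_convergent[OF B])
        fix c assume c: "c \<in> B" "(b, c) \<in> s"
        have "z \<le> apply_op \<bar>S\<^sub>0\<bar> (y c)" using z[OF c(1)] .
        also have "\<dots> \<le> apply_op (U i) (y c) + apply_op \<bar>S \<alpha>\<bar> (y c)"
          using ob_operator_leD[OF le decreases_to_zero_nonneg[OF y c(1)]]
          by (simp add: op_eval add.commute)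
        also have "\<dots> \<le> apply_op (U i) (y b) + apply_op \<bar>S \<alpha>\<bar> (y c)"
          using decreases_to_zero_nonneg[OF U i] decreases_to_zero_mono[OF y b c]
          by (intro add_right_mono positive_op_mono)
        finally show "z \<le> apply_op (U i) (y b) + apply_op \<bar>S \<alpha>\<bar> (y c)" .
      qed
    qed
  qed
qed


section \<open>Order continuity of the product\<close>

lemma order_convergent_comp_op:
  fixes S :: "'i \<Rightarrow> 'a::dedekind_complete_vector_lattice ob_operator"
    and T :: "'j \<Rightarrow> 'a ob_operator"
  assumes S\<^sub>0: "S\<^sub>0 \<in> order_continuous_ops"
    and S: "order_convergent A r S S\<^sub>0"
    and B: "directed_set B s" and T: "order_convergent B s T T\<^sub>0"
  shows "order_convergent (A \<times> B) (product_order r s) (\<lambda>(\<alpha>, \<beta>). S \<alpha> \<cdot> T \<beta>) (S\<^sub>0 \<cdot> T\<^sub>0)"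
proof -
  obtain I :: "'a ob_operator set" and t U where I: "directed_set I t"
    and U: "decreases_to_zero I t U"
    and domU: "\<forall>i\<in>I. \<exists>a\<^sub>0\<in>A. \<forall>a\<in>A. (a\<^sub>0, a) \<in> r \<longrightarrow> \<bar>S\<^sub>0 - S a\<bar> \<le> U i"
    using S unfolding order_convergent_def by blast
  obtain J :: "'a ob_operator set" and u V where J: "directed_set J u"
    and V: "decreases_to_zero J u V"
    and domV: "\<forall>j\<in>J. \<exists>b\<^sub>0\<in>B. \<forall>b\<in>B. (b\<^sub>0, b) \<in> s \<longrightarrow> \<bar>T\<^sub>0 - T b\<bar> \<le> V j"
    using T unfolding order_convergent_def by blast
  \<comment> \<open>A single index \<open>k\<close> is enough to bound \<open>\<bar>T b\<bar>\<close> eventually by one operator \<open>W\<close>, which keeps the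
    first summand of the dominating net dependent on \<open>i\<close> alone.\<close>
  obtain k where k: "k \<in> J" using J unfolding directed_set_def by blast
  define W where "W = \<bar>T\<^sub>0\<bar> + V k"
  have W: "0 \<le> W"
    unfolding W_def using decreases_to_zero_nonneg[OF V k] by simp
  define Z where "Z = (\<lambda>(i, j). U i \<cdot> W + \<bar>S\<^sub>0\<bar> \<cdot> V j)"
  note IJ = directed_set_product[OF I J]
  have "decreases_to_zero (I \<times> J) (product_order t u) (\<lambda>p. apply_op (Z p) x)"
    if x: "0 \<le> x" for x
  proof -
    have "decreases_to_zero I t (\<lambda>i. apply_op (U i) (apply_op W x))"
      by (rule decreases_to_zero_apply_op[OF I U positive_op_nonneg[OF W x]])
    moreover have "decreases_to_zero J u (\<lambda>j. apply_op \<bar>S\<^sub>0\<bar> (apply_op (V j) x))"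
      by (rule decreases_to_zero_abs_op[OF S\<^sub>0 J decreases_to_zero_apply_op[OF J V x]])
    ultimately have "decreases_to_zero (I \<times> J) (product_order t u)
        (\<lambda>(i, j). apply_op (U i) (apply_op W x) + apply_op \<bar>S\<^sub>0\<bar> (apply_op (V j) x))"
      by (rule decreases_to_zero_add_product)
    then show ?thesis
      by (simp add: Z_def op_eval case_prod_unfold)
  qed
  then have Z: "decreases_to_zero (I \<times> J) (product_order t u) Z"
    by (simp add: decreases_to_zero_op_iff[OF IJ])
  show ?thesis
  proof (rule order_convergentI[OF IJ Z])
    fix p assume "p \<in> I \<times> J"
    then obtain i j where p: "p = (i, j)" and ij: "i \<in> I" "j \<in> J" by blast
    obtain a\<^sub>0 where a0: "a\<^sub>0 \<in> A" "\<And>a. a \<in> A \<Longrightarrow> (a\<^sub>0, a) \<in> r \<Longrightarrow> \<bar>S\<^sub>0 - S a\<bar> \<le> U i"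
      using domU ij by blast
    obtain b\<^sub>1 where b1: "b\<^sub>1 \<in> B" "\<And>b. b \<in> B \<Longrightarrow> (b\<^sub>1, b) \<in> s \<Longrightarrow> \<bar>T\<^sub>0 - T b\<bar> \<le> V j"
      using domV ij by blast
    obtain b\<^sub>2 where b2: "b\<^sub>2 \<in> B" "\<And>b. b \<in> B \<Longrightarrow> (b\<^sub>2, b) \<in> s \<Longrightarrow> \<bar>T\<^sub>0 - T b\<bar> \<le> V k"
      using domV k by blast
    obtain b\<^sub>0 where b0: "b\<^sub>0 \<in> B" "(b\<^sub>1, b\<^sub>0) \<in> s" "(b\<^sub>2, b\<^sub>0) \<in> s"
      using directed_set_upper[OF B b1(1) b2(1)] .
    have "\<bar>S\<^sub>0 \<cdot> T\<^sub>0 - S a \<cdot> T b\<bar> \<le> Z p"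
      if a: "a \<in> A" "(a\<^sub>0, a) \<in> r" and b: "b \<in> B" "(b\<^sub>0, b) \<in> s" for a b
    proof -
      have Sa: "\<bar>S\<^sub>0 - S a\<bar> \<le> U i" using a0 a by blast
      have Tb: "\<bar>T\<^sub>0 - T b\<bar> \<le> V j" "\<bar>T\<^sub>0 - T b\<bar> \<le> V k"
        using b1 b2 b b0 directed_set_trans[OF B] by blast+
      have "\<bar>T b\<bar> \<le> \<bar>T\<^sub>0\<bar> + \<bar>T\<^sub>0 - T b\<bar>"
        using abs_triangle_ineq4[of "T\<^sub>0" "T\<^sub>0 - T b"] by simp
      also have "\<dots> \<le> W" unfolding W_def using Tb(2) by simp
      finally have TW: "\<bar>T b\<bar> \<le> W" .
      have "\<bar>S\<^sub>0 \<cdot> T\<^sub>0 - S a \<cdot> T b\<bar> \<le> \<bar>(S\<^sub>0 - S a) \<cdot> T b\<bar> + \<bar>S\<^sub>0 \<cdot> (T\<^sub>0 - T b)\<bar>"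
        unfolding comp_op_diff_eq by (rule abs_triangle_ineq)
      also have "\<dots> \<le> \<bar>S\<^sub>0 - S a\<bar> \<cdot> \<bar>T b\<bar> + \<bar>S\<^sub>0\<bar> \<cdot> \<bar>T\<^sub>0 - T b\<bar>"
        by (intro add_mono abs_comp_op_le)
      also have "\<dots> \<le> U i \<cdot> W + \<bar>S\<^sub>0\<bar> \<cdot> V j"
        using Sa Tb(1) TW W decreases_to_zero_nonneg[OF V ij(2)]
        by (intro add_mono comp_op_mono) simp_all
      finally show ?thesis by (simp add: Z_def p)
    qed
    then show "\<exists>q\<in>A \<times> B. \<forall>q'\<in>A \<times> B. (q, q') \<in> product_order r s \<longrightarrow>
        \<bar>S\<^sub>0 \<cdot> T\<^sub>0 - (case q' of (\<alpha>, \<beta>) \<Rightarrow> S \<alpha> \<cdot> T \<beta>)\<bar> \<le> Z p"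
      using a0(1) b0(1) by (intro bexI[of _ "(a\<^sub>0, b\<^sub>0)"]) (auto simp: product_order_def)
  qed
qed

theorem proposition5p1:
  fixes A :: "'i set" and r :: "'i rel" and B :: "'j set" and s :: "'j rel"
    and S :: "'i \<Rightarrow> 'a::dedekind_complete_vector_lattice ob_operator" and S\<^sub>0 :: "'a ob_operator"
    and T :: "'j \<Rightarrow> 'a ob_operator" and T\<^sub>0 :: "'a ob_operator"
  assumes "directed_set A r"
    and "\<And>\<alpha>. \<alpha> \<in> A \<Longrightarrow> S \<alpha> \<in> order_continuous_ops"
    and "order_convergent A r S S\<^sub>0"
    and "directed_set B s"
    and "order_convergent B s T T\<^sub>0"
  shows "S\<^sub>0 \<in> order_continuous_ops \<and>
    order_convergent (A \<times> B) (product_order r s) (\<lambda>(\<alpha>, \<beta>). S \<alpha> \<cdot> T \<beta>) (S\<^sub>0 \<cdot> T\<^sub>0)"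
proof -
  have "S\<^sub>0 \<in> order_continuous_ops"
    by (rule order_continuous_ops_limit[OF assms(1-3)])
  then show ?thesis
    using order_convergent_comp_op assms(3-5) by blast
qed

end
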